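(* Fix $\alpha>0$ and for each integer $n\ge 2$ consider the continuous-time $M/M/n$ queue with arrival rate $\lambda_n=n-n^{1-\alpha}$ and service rate $1$. Let $\pi_{n,t}$ be the distribution of the number of customers at time $t\ge 0$ and $\nu_n$ the stationary distribution. (i) If $\alpha\ge 1$, then for every $n\ge 2$ and every initial distribution $\pi_{n,0}$, $$\chi(\pi_{n,t},\nu_n)\le e^{-(\sqrt n-\sqrt{\lambda_n})^2t}\,\chi(\pi_{n,0},\nu_n)\qquad\forall t\ge 0.$$ (ii) If $\alpha\in(1/2,1)$, there exist $C_n>0$ (not depending on $t$ or $\pi_{n,0}$) with $\lim_{n\to\infty}C_n=1$ such that for every $n\ge2$ and every $\pi_{n,0}$, $$\chi(\pi_{n,t},\nu_n)\le e^{-C_n(\sqrt n-\sqrt{\lambda_n})^2t}\,\chi(\pi_{n,0},\nu_n)\qquad\forall t\ge 0.$$ (iii) If $\alpha\in(0,1/2)$, there exist $D_n>0$ (not depending on $t$ or $\pi_{n,0}$) with $\lim_{n\to\infty}D_n=1/25$ such that for every $n\ge2$ and every $\pi_{n,0}$, $$\chi(\pi_{n,t},\nu_n)\le e^{-D_nt}\,\chi(\pi_{n,0},\nu_n)\qquad\forall t\ge 0.$$ (iv) If $\alpha=1/2$, there exist $H_n$ (not depending on $t$ or $\pi_{n,0}$) with $H_n>\frac1{10861}$ for all $n\ge110$ and $\lim_{n\to\infty}H_n=\frac1{1781}$ such that for every $n\ge110$ and every $\pi_{n,0}$, $$\chi(\pi_{n,t},\nu_n)\le e^{-H_nt}\,\chi(\pi_{n,0},\nu_n)\qquad\forall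 t\ge 0.$$
   Context: The $M/M/n$ queue with arrival rate $\lambda$ and service rate $1$ is the continuous-time birth-and-death Markov chain on $\mathbb Z_{\ge0}$ (state = number of customers) with birth rate $\lambda$ in every state and death rate $\min\{n,q\}$ in state $q$. For $0<\lambda<n$ it has a unique stationary distribution. For probability distributions $P,Q$ on a countable set $S$ with $P$ absolutely continuous with respect to $Q$, $\chi^2(P,Q)=\sum_{x\in S}\frac{(P(x)-Q(x))^2}{Q(x)}$ and $\chi(P,Q)=\sqrt{\chi^2(P,Q)}\in[0,\infty]$; if $\chi(\pi_{n,0},\nu_n)=\infty$ the bounds are vacuous. *)

theory Defs
  imports "HOL-Probability.Probability"
begin

(* Rows sum to 0 only if d 0 = 0. *)
definition birth_death_rate :: "(nat \<Rightarrow> real) \<Rightarrow> (nat \<Rightarrow> real) \<Rightarrow> nat \<Rightarrow> nat \<Rightarrow> real" where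
  "birth_death_rate b d x y =
     (if y = Suc x then b x
      else if x = Suc y then d x
      else if x = y then - (b x + d x)
      else 0)"

definition mmn_rate :: "nat \<Rightarrow> real \<Rightarrow> nat \<Rightarrow> nat \<Rightarrow> real" where
  "mmn_rate n l = birth_death_rate (\<lambda>_. l) (\<lambda>q. real (min n q))"

(* P t x is the law at time t of the chain started at x; only t \<ge> 0 is relevant.
   For bounded rates, as in the M/M/n queue, q determines P t for all t \<ge> 0. *)
definition ctmc_transition :: "('a \<Rightarrow> 'a \<Rightarrow> real) \<Rightarrow> (real \<Rightarrow> 'a \<Rightarrow> 'a pmf) \<Rightarrow> bool" where
  "ctmc_transition q P \<longleftrightarrow>
     (\<forall>x. P 0 x = return_pmf x) \<and>
     (\<forall>s\<ge>0. \<forall>t\<ge>0. \<forall>x. P (s + t) x = bind_pmf (P s x) (P t)) \<and>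
     (\<forall>x y. ((\<lambda>t. pmf (P t x) y) has_real_derivative q x y) (at 0 within {0..}))"

definition ctmc_law :: "(real \<Rightarrow> 'a \<Rightarrow> 'a pmf) \<Rightarrow> 'a pmf \<Rightarrow> real \<Rightarrow> 'a pmf" where
  "ctmc_law P \<pi>0 t = bind_pmf \<pi>0 (P t)"

definition ctmc_stationary :: "(real \<Rightarrow> 'a \<Rightarrow> 'a pmf) \<Rightarrow> 'a pmf \<Rightarrow> bool" where
  "ctmc_stationary P \<nu> \<longleftrightarrow> (\<forall>t\<ge>0. ctmc_law P \<nu> t = \<nu>)"

(* In ennreal, 0 / 0 = 0 and a / 0 = \<infinity> for a \<noteq> 0, so the value is \<infinity> whenever
   p is not absolutely continuous with respect to q. *)
definition chi_sq_dist :: "'a pmf \<Rightarrow> 'a pmf \<Rightarrow> ennreal" where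
  "chi_sq_dist p q =
     (\<integral>\<^sup>+ x. ennreal ((pmf p x - pmf q x)\<^sup>2) / ennreal (pmf q x) \<partial>count_space UNIV)"

definition chi_dist :: "'a pmf \<Rightarrow> 'a pmf \<Rightarrow> ennreal" where
  "chi_dist p q =
     (if chi_sq_dist p q = \<infinity> then \<infinity> else ennreal (sqrt (enn2real (chi_sq_dist p q))))"

definition hw_arrival :: "real \<Rightarrow> nat \<Rightarrow> real" where
  "hw_arrival \<alpha> n = real n - real n powr (1 - \<alpha>)"

(* Contraction of the M/M/n queue in chi distance at exponential rate r, uniformly over
   all initial distributions. *)
definition mmn_chi_decay :: "nat \<Rightarrow> real \<Rightarrow> real \<Rightarrow> bool" where
  "mmn_chi_decay n l r \<longleftrightarrow>
     (\<forall>P \<nu>. ctmc_transition (mmn_rate n l) P \<longrightarrow> ctmc_stationary P \<nu> \<longrightarrow>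
       (\<forall>\<pi>0. \<forall>t\<ge>0. chi_dist (ctmc_law P \<pi>0 t) \<nu> \<le> ennreal (exp (- r * t)) * chi_dist \<pi>0 \<nu>))"

end

theory Submission
  imports Defs
begin

text \<open>For a birth-death chain with stationary law \<open>\<nu>\<close>, birth rates \<open>b\<close> and death rates \<open>d\<close>, write
  \<open>G\<^sub>i\<close> for the partial sums of \<open>\<nu> f\<close>, where \<open>f\<close> has mean zero. Since \<open>(G\<^sub>i - G\<^sub>j)\<^sup>2 \<ge> (1 - \<theta>\<^sub>i) G\<^sub>i\<^sup>2 + (1 - 1 / \<theta>\<^sub>i) G\<^sub>j\<^sup>2\<close>
  for \<open>j = i - 1\<close> and any \<open>\<theta>\<^sub>i > 0\<close>, the weighted Hardy inequality \<open>\<nu>(f\<^sup>2) \<ge> \<gamma> \<Sum> G\<^sub>i\<^sup>2 / (\<nu>\<^sub>i b\<^sub>i)\<close> holds as soon as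
  \<open>b\<^sub>i (1 - \<theta>\<^sub>i) + d\<^sub>k (1 - 1 / \<theta>\<^sub>k) \<ge> \<gamma>\<close> for all \<open>i\<close> and \<open>k = i + 1\<close>. Summation by parts,
  \<open>\<nu>(f\<^sup>2) = - \<Sum> G\<^sub>i (f\<^sub>k - f\<^sub>i)\<close>, turns it into the Poincare inequality with constant \<open>\<gamma>\<close>, hence into exponential
  decay of the variance of \<open>P\<^sub>t f\<close> for bounded \<open>f\<close>, and by duality into contraction of \<open>\<chi>\<close>.

  For the \<open>M/M/n\<close> queue the weights \<open>\<theta>\<^sub>i = min (\<mu>\<^sub>i / \<lambda>) (sqrt (\<mu>\<^sub>i / \<lambda>))\<close> with \<open>\<mu>\<^sub>i = min n i\<close> give
  \<open>\<gamma> = min (1/2) ((sqrt n - sqrt \<lambda>)\<^sup>2)\<close>. As \<open>(sqrt n - sqrt \<lambda>)\<^sup>2\<close> lies between \<open>z / 4\<close> and \<open>z\<close> for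
  \<open>z = n powr (1 - 2 * \<alpha>)\<close>, this is more than every regime of \<open>\<alpha>\<close> requires.\<close>

section \<open>Continuity and derivatives on the half-line from forward increments\<close>

text \<open>The semigroup law controls only forward increments. As \<open>\<eta>\<close> is uniform
  in the base point, a point \<open>y < t\<close> is handled by the forward increment based at
  \<open>y\<close>.\<close>

lemma continuous_on_atLeast_modulus:
  fixes \<phi> \<eta> :: "real \<Rightarrow> real"
  assumes lim: "(\<eta> \<longlongrightarrow> 0) (at_right 0)"
    and bound: "\<And>t s. t \<ge> 0 \<Longrightarrow> s > 0 \<Longrightarrow> \<bar>\<phi> (t + s) - \<phi> t\<bar> \<le> \<eta> s"
  shows "continuous_on {0..} \<phi>"
  unfolding continuous_on_def
proof
  fix t :: real assume t: "t \<in> {0..}"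
  have abs: "filterlim (\<lambda>y. \<bar>y - t\<bar>) (at_right 0) (at t within {0..})"
    unfolding filterlim_at
    by (auto intro!: tendsto_eq_intros eventually_at_leftI simp: eventually_at_filter)
  have "((\<lambda>y. \<eta> \<bar>y - t\<bar>) \<longlongrightarrow> 0) (at t within {0..})"
    by (rule filterlim_compose[OF lim abs])
  moreover have "\<forall>\<^sub>F y in at t within {0..}. norm (\<phi> y - \<phi> t) \<le> \<eta> \<bar>y - t\<bar>"
    unfolding eventually_at_filter
  proof (intro always_eventually allI impI)
    fix y assume y: "y \<noteq> t" "y \<in> {0..}"
    show "norm (\<phi> y - \<phi> t) \<le> \<eta> \<bar>y - t\<bar>"
    proof (cases "y > t")
      case True
      then show ?thesis using bound[of t "y - t"] t by simp
    next
      case False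
      then show ?thesis using bound[of y "t - y"] y by (simp add: abs_minus_commute)
    qed
  qed
  ultimately have "((\<lambda>y. \<phi> y - \<phi> t) \<longlongrightarrow> 0) (at t within {0..})"
    by (rule Lim_null_comparison[rotated])
  then show "(\<phi> \<longlongrightarrow> \<phi> t) (at t within {0..})"
    using LIM_zero_iff by blast
qed

text \<open>For \<open>y < t\<close> the difference quotient is a forward quotient based at
  \<open>y\<close>, hence close to \<open>\<psi> y\<close>; continuity of \<open>\<psi>\<close>
  replaces this by \<open>\<psi> t\<close>. The base point is \<open>min y t\<close> on either
  side.\<close>

lemma has_real_derivative_atLeast_modulus:
  fixes \<phi> \<psi> \<delta> :: "real \<Rightarrow> real"
  assumes lim: "(\<delta> \<longlongrightarrow> 0) (at_right 0)"
    and cont: "continuous_on {0..} \<psi>"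
    and bound: "\<And>t s. t \<ge> 0 \<Longrightarrow> s > 0 \<Longrightarrow> \<bar>\<phi> (t + s) - \<phi> t - s * \<psi> t\<bar> \<le> s * \<delta> s"
    and t: "t \<ge> 0"
  shows "(\<phi> has_real_derivative \<psi> t) (at t within {0..})"
proof -
  have abs: "filterlim (\<lambda>y. \<bar>y - t\<bar>) (at_right 0) (at t within {0..})"
    unfolding filterlim_at
    by (auto intro!: tendsto_eq_intros simp: eventually_at_filter)
  have "((\<lambda>y. \<psi> (min y t)) \<longlongrightarrow> \<psi> (min t t)) (at t within {0..})"
  proof -
    have "continuous_on {0..} (\<lambda>y. \<psi> (min y t))"
      by (rule continuous_on_compose2[OF cont]) (auto intro!: continuous_intros simp: t)
    then show ?thesis using t unfolding continuous_on_def by (metis atLeast_iff)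
  qed
  then have 1: "((\<lambda>y. \<bar>\<psi> (min y t) - \<psi> t\<bar>) \<longlongrightarrow> 0) (at t within {0..})"
    by (auto intro!: tendsto_eq_intros)
  have 2: "((\<lambda>y. \<delta> \<bar>y - t\<bar>) \<longlongrightarrow> 0) (at t within {0..})"
    by (rule filterlim_compose[OF lim abs])
  have 3: "((\<lambda>y. \<delta> \<bar>y - t\<bar> + \<bar>\<psi> (min y t) - \<psi> t\<bar>) \<longlongrightarrow> 0) (at t within {0..})"
    using tendsto_add[OF 2 1] by simp
  have 4: "\<forall>\<^sub>F y in at t within {0..}. norm ((\<phi> y - \<phi> t) / (y - t) - \<psi> t)
      \<le> \<delta> \<bar>y - t\<bar> + \<bar>\<psi> (min y t) - \<psi> t\<bar>"
    unfolding eventually_at_filter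
  proof (intro always_eventually allI impI)
    fix y assume y: "y \<noteq> t" "y \<in> {0..}"
    let ?h = "\<bar>y - t\<bar>"
    have h: "?h > 0" using y by simp
    have quot: "(\<phi> y - \<phi> t) / (y - t) = (\<phi> (min y t + ?h) - \<phi> (min y t)) / ?h"
    proof (cases "y > t")
      case False
      then have "min y t = y" "?h = t - y" using y by auto
      then show ?thesis
        using minus_divide_divide[of "\<phi> t - \<phi> y" "t - y"] by simp
    qed simp
    have "\<bar>\<phi> (min y t + ?h) - \<phi> (min y t) - ?h * \<psi> (min y t)\<bar> \<le> ?h * \<delta> ?h"
      by (rule bound) (use y t in auto)
    then have "\<bar>(\<phi> (min y t + ?h) - \<phi> (min y t) - ?h * \<psi> (min y t)) / ?h\<bar> \<le> \<delta> ?h"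
      using h by (simp add: abs_divide pos_divide_le_eq mult.commute)
    then have "\<bar>(\<phi> (min y t + ?h) - \<phi> (min y t)) / ?h - \<psi> (min y t)\<bar> \<le> \<delta> ?h"
      using h by (simp add: diff_divide_distrib)
    then show "norm ((\<phi> y - \<phi> t) / (y - t) - \<psi> t) \<le> \<delta> ?h + \<bar>\<psi> (min y t) - \<psi> t\<bar>"
      unfolding quot real_norm_def by linarith
  qed
  have "((\<lambda>y. (\<phi> y - \<phi> t) / (y - t) - \<psi> t) \<longlongrightarrow> 0) (at t within {0..})"
    by (rule Lim_null_comparison[OF 4 3])
  then show ?thesis
    unfolding has_field_derivative_iff using LIM_zero_iff by blast
qed

section \<open>Expectations of bounded functions\<close>

lemma integrable_pmf_bounded:
  fixes f :: "'a \<Rightarrow> real"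
  assumes "\<And>x. \<bar>f x\<bar> \<le> M"
  shows "integrable (measure_pmf p) f"
  using assms by (intro measure_pmf.integrable_const_bound[where B = M]) auto

lemma abs_expectation_pmf_le:
  fixes f :: "'a \<Rightarrow> real"
  assumes "\<And>x. \<bar>f x\<bar> \<le> M"
  shows "\<bar>measure_pmf.expectation p f\<bar> \<le> M"
proof -
  have "measure_pmf.expectation p f \<le> M"
    using measure_pmf.integral_le_const[OF integrable_pmf_bounded[of f M p]] assms
    by (simp add: abs_le_iff)
  moreover have "measure_pmf.expectation p f \<ge> - M"
    using measure_pmf.integral_ge_const[OF integrable_pmf_bounded[of f M p], of "-M"] assms
    by (simp add: abs_le_iff minus_le_iff)
  ultimately show ?thesis by (simp add: abs_le_iff)
qed

lemma expectation_pmf_sums: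
  fixes f :: "nat \<Rightarrow> real"
  assumes "\<And>x. \<bar>f x\<bar> \<le> M"
  shows "(\<lambda>x. pmf p x * f x) sums measure_pmf.expectation p f"
proof -
  have "integrable (density (count_space UNIV) (\<lambda>x. ennreal (pmf p x))) f"
    using integrable_pmf_bounded[of f M p] assms by (simp flip: measure_pmf_eq_density)
  then have "integrable (count_space UNIV) (\<lambda>x. pmf p x *\<^sub>R f x)"
    by (subst (asm) integrable_density) auto
  moreover have "measure_pmf.expectation p f = (\<integral>x. pmf p x *\<^sub>R f x \<partial>count_space UNIV)"
    by (subst measure_pmf_eq_density, subst integral_density) auto
  ultimately show ?thesis
    using sums_integral_count_space_nat[of "\<lambda>x. pmf p x *\<^sub>R f x"] by simp
qed

text \<open>The series for the expectation is differentiated term by term; the M-test with majorant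
  \<open>pmf p x * M'\<close> gives uniform convergence of the derivatives.\<close>

lemma expectation_pmf_has_derivative:
  fixes F F' :: "real \<Rightarrow> nat \<Rightarrow> real"
  assumes deriv: "\<And>x t. t \<ge> 0 \<Longrightarrow> ((\<lambda>t. F t x) has_real_derivative F' t x) (at t within {0..})"
    and F: "\<And>x t. t \<ge> 0 \<Longrightarrow> \<bar>F t x\<bar> \<le> M"
    and F': "\<And>x t. t \<ge> 0 \<Longrightarrow> \<bar>F' t x\<bar> \<le> M'"
    and t: "t \<ge> 0"
  shows "((\<lambda>t. measure_pmf.expectation p (F t)) has_real_derivative
           measure_pmf.expectation p (F' t)) (at t within {0..})"
proof -
  have sF: "(\<lambda>x. pmf p x * F t x) sums measure_pmf.expectation p (F t)" if "t \<ge> 0" for t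
    by (rule expectation_pmf_sums) (rule F[OF that])
  have sF': "(\<lambda>x. pmf p x * F' t x) sums measure_pmf.expectation p (F' t)" if "t \<ge> 0" for t
    by (rule expectation_pmf_sums) (rule F'[OF that])
  have "uniform_limit {0..} (\<lambda>n t. \<Sum>x<n. pmf p x * F' t x) (\<lambda>t. \<Sum>x. pmf p x * F' t x) sequentially"
  proof (rule Weierstrass_m_test)
    show "norm (pmf p x * F' t x) \<le> pmf p x * M'" if "t \<in> {0..}" for x t
      using F'[of t x] that by (auto simp: abs_mult intro!: mult_left_mono)
    show "summable (\<lambda>x. pmf p x * M')"
      using expectation_pmf_sums[of "\<lambda>_. M'" "\<bar>M'\<bar>" p] by (auto simp: sums_iff)
  qed
  then have "uniform_limit {0..} (\<lambda>n t. \<Sum>x<n. pmf p x * F' t x)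
      (\<lambda>t. measure_pmf.expectation p (F' t)) sequentially"
    by (rule uniform_limit_cong'[THEN iffD1, rotated -1]) (use sF' in \<open>auto simp: sums_iff\<close>)
  then have "\<exists>g. \<forall>t\<in>{0..}. (\<lambda>x. pmf p x * F t x) sums g t \<and>
      (g has_field_derivative measure_pmf.expectation p (F' t)) (at t within {0..})"
  proof (rule has_field_derivative_series[rotated 2])
    show "((\<lambda>t. pmf p x * F t x) has_real_derivative pmf p x * F' t x) (at t within {0..})"
      if "t \<in> {0..}" for x t
      using deriv[of t x] that by (intro DERIV_cmult) auto
    show "summable (\<lambda>x. pmf p x * F 0 x)"
      using sF[of 0] by (simp add: sums_iff)
  qed auto
  then obtain g where g: "\<And>t. t \<ge> 0 \<Longrightarrow> (\<lambda>x. pmf p x * F t x) sums g t \<and>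
      (g has_real_derivative measure_pmf.expectation p (F' t)) (at t within {0..})"
    by (metis atLeast_iff)
  have "g t = measure_pmf.expectation p (F t)" if "t \<ge> 0" for t
    using sums_unique2[OF conjunct1[OF g[OF that]] sF[OF that]] .
  then show ?thesis
    by (intro has_field_derivative_transform_within[OF conjunct2[OF g[OF t]], of 1]) (use t in auto)
qed

lemma expectation_bind_pmf_bounded:
  fixes f :: "'b \<Rightarrow> real"
  assumes "\<And>x. \<bar>f x\<bar> \<le> M"
  shows "measure_pmf.expectation (bind_pmf p k) f
       = measure_pmf.expectation p (\<lambda>x. measure_pmf.expectation (k x) f)"
proof -
  have "(\<lambda>x. measure_pmf (k x)) \<in> measurable (measure_pmf p) (subprob_algebra (count_space UNIV))"
    by (auto simp: measurable_def measure_pmf_in_subprob_algebra)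
  moreover have "finite_measure (measure_pmf p)"
    by unfold_locales
  moreover have "AE x in measure_pmf p. emeasure (k x) (space (k x)) \<le> ennreal 1"
    by (simp add: measure_pmf.emeasure_space_1)
  ultimately show ?thesis
    unfolding measure_pmf_bind using assms
    by (intro integral_bind[where K = "count_space UNIV" and B' = 1 and B = M]) auto
qed

section \<open>The transition semigroup and its backward equation\<close>

text \<open>At \<open>x = 0\<close> truncated subtraction gives \<open>g (x - 1) = g x\<close>, so
  the death term vanishes there.\<close>

definition bd_gen :: "(nat \<Rightarrow> real) \<Rightarrow> (nat \<Rightarrow> real) \<Rightarrow> (nat \<Rightarrow> real) \<Rightarrow> nat \<Rightarrow> real" where
  "bd_gen b d g x = b x * (g (Suc x) - g x) + d x * (g (x - 1) - g x)"

lemma bd_gen_diff_const: "bd_gen b d (\<lambda>x. g x - m) = bd_gen b d g"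
  by (rule ext) (simp add: bd_gen_def)

locale birth_death_semigroup =
  fixes b d :: "nat \<Rightarrow> real" and c :: real and P :: "real \<Rightarrow> nat \<Rightarrow> nat pmf"
  assumes b_nonneg: "0 \<le> b x" and b_le: "b x \<le> c"
    and d_nonneg: "0 \<le> d x" and d_le: "d x \<le> c" and d_0: "d 0 = 0"
    and transition: "ctmc_transition (birth_death_rate b d) P"
begin

abbreviation "gen \<equiv> bd_gen b d"

definition trans_op :: "(nat \<Rightarrow> real) \<Rightarrow> real \<Rightarrow> nat \<Rightarrow> real" where
  "trans_op f t x = measure_pmf.expectation (P t x) f"

lemma P_0: "P 0 x = return_pmf x"
  using transition by (simp add: ctmc_transition_def)

lemma abs_gen_le:
  assumes "\<And>x. \<bar>g x\<bar> \<le> M"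
  shows "\<bar>gen g x\<bar> \<le> 4 * c * M"
proof -
  have diff: "\<bar>g y - g z\<bar> \<le> 2 * M" for y z
    using assms[of y] assms[of z] by linarith
  have "\<bar>b x * (g (Suc x) - g x)\<bar> \<le> c * (2 * M)"
    unfolding abs_mult by (intro mult_mono) (use b_nonneg b_le diff order_trans[OF b_nonneg b_le] in auto)
  moreover have "\<bar>d x * (g (x - 1) - g x)\<bar> \<le> c * (2 * M)"
    unfolding abs_mult by (intro mult_mono) (use d_nonneg d_le diff order_trans[OF b_nonneg b_le] in auto)
  ultimately show ?thesis unfolding bd_gen_def by linarith
qed

text \<open>At \<open>x = 0\<close> the index set has only two elements, and \<open>d_0\<close>
  removes the death rate from the diagonal entry. The case \<open>g = 1\<close> says that row sums
  vanish.\<close>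

lemma sum_rate_eq_gen: "(\<Sum>z\<in>{x - 1, x, Suc x}. birth_death_rate b d x z * g z) = gen g x"
proof (cases x)
  case 0
  then show ?thesis by (simp add: birth_death_rate_def bd_gen_def d_0 algebra_simps)
next
  case (Suc y)
  then show ?thesis by (simp add: birth_death_rate_def bd_gen_def algebra_simps)
qed

text \<open>Row sums of the rate matrix vanish, so the mass that \<open>P s x\<close> puts outside the neighbours
  of \<open>x\<close> is \<open>o(s)\<close>; hence pointwise differentiability of the transition probabilities at \<open>0\<close>
  already controls all bounded test functions at once.\<close>

lemma generator_modulus:
  obtains \<delta> where "(\<delta> \<longlongrightarrow> 0) (at_right 0)"
    and "\<And>s g M. s > 0 \<Longrightarrow> (\<And>z. \<bar>g z\<bar> \<le> M) \<Longrightarrow>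
      \<bar>measure_pmf.expectation (P s x) g - g x - s * gen g x\<bar> \<le> s * (M * \<delta> s)"
proof -
  define N where "N = {x - 1, x, Suc x}"
  define q where "q = birth_death_rate b d x"
  define e where "e s z = (pmf (P s x) z - of_bool (z = x)) / s - q z" for s z
  \<comment> \<open>The first sum controls a test function on \<open>N\<close>, the second term
    controls it off \<open>N\<close>; neither depends on the test function.\<close>
  define \<delta> where "\<delta> s = (\<Sum>z\<in>N. \<bar>e s z\<bar>) + (1 - (\<Sum>z\<in>N. pmf (P s x) z)) / s" for s
  have fin: "finite N" and xN: "x \<in> N" unfolding N_def by auto
  have e_0: "((\<lambda>s. e s z) \<longlongrightarrow> 0) (at_right 0)" for z
  proof -
    have "((\<lambda>t. pmf (P t x) z) has_real_derivative q z) (at 0 within {0..})"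
      using transition by (simp add: ctmc_transition_def q_def)
    then have "((\<lambda>t. pmf (P t x) z) has_real_derivative q z) (at_right 0)"
      by (rule has_field_derivative_subset) auto
    then have "((\<lambda>s. (pmf (P s x) z - of_bool (z = x)) / s) \<longlongrightarrow> q z) (at_right 0)"
      unfolding has_field_derivative_iff by (simp add: P_0 of_bool_def indicator_def eq_commute)
    then show ?thesis unfolding e_def using LIM_zero by blast
  qed
  have sum_q: "(\<Sum>z\<in>N. q z) = 0"
    using sum_rate_eq_gen[of x "\<lambda>_. 1"] by (simp add: N_def q_def bd_gen_def)
  \<comment> \<open>The point mass at \<open>x\<close> has total 1 on \<open>N\<close> and the rates
    sum to 0, so the escaping mass is minus the total error and inherits its limit.\<close>
  have out: "(1 - (\<Sum>z\<in>N. pmf (P s x) z)) / s = - (\<Sum>z\<in>N. e s z)" for s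
  proof -
    have "(\<Sum>z\<in>N. e s z) = ((\<Sum>z\<in>N. pmf (P s x) z) - (\<Sum>z\<in>N. of_bool (z = x))) / s"
      by (simp add: e_def sum_subtractf sum_q flip: sum_divide_distrib)
    then show ?thesis using fin xN by (simp add: of_bool_def diff_divide_distrib)
  qed
  have "((\<lambda>s. (1 - (\<Sum>z\<in>N. pmf (P s x) z)) / s) \<longlongrightarrow> - (\<Sum>z\<in>N. 0)) (at_right 0)"
    by (subst out) (intro tendsto_intros e_0)
  then have "(\<delta> \<longlongrightarrow> (\<Sum>z\<in>N. \<bar>0\<bar>) + - (\<Sum>z\<in>N. 0)) (at_right 0)"
    unfolding \<delta>_def by (intro tendsto_intros e_0)
  then have lim: "(\<delta> \<longlongrightarrow> 0) (at_right 0)" by simp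
  have bound: "\<bar>measure_pmf.expectation (P s x) g - g x - s * gen g x\<bar> \<le> s * (M * \<delta> s)"
    if s: "s > 0" and g: "\<And>z. \<bar>g z\<bar> \<le> M" for s g M
  proof -
    let ?p = "P s x"
    have split: "measure_pmf.expectation ?p g = (\<Sum>z\<in>N. g z * pmf ?p z)
        + measure_pmf.expectation ?p (\<lambda>z. g z * indicator (- N) z)"
    proof -
      have "measure_pmf.expectation ?p (\<lambda>z. g z * indicator N z) = (\<Sum>z\<in>N. g z * indicator N z * pmf ?p z)"
        by (rule integral_measure_pmf_real[OF fin]) (auto simp: indicator_def split: if_splits)
      also have "\<dots> = (\<Sum>z\<in>N. g z * pmf ?p z)"
        by (rule sum.cong) auto
      finally have 1: "measure_pmf.expectation ?p (\<lambda>z. g z * indicator N z) = (\<Sum>z\<in>N. g z * pmf ?p z)" .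
      have "g = (\<lambda>z. g z * indicator N z + g z * indicator (- N) z)"
        by (auto simp: indicator_def)
      then have "measure_pmf.expectation ?p g
          = measure_pmf.expectation ?p (\<lambda>z. g z * indicator N z + g z * indicator (- N) z)" by simp
      also have "\<dots> = measure_pmf.expectation ?p (\<lambda>z. g z * indicator N z)
          + measure_pmf.expectation ?p (\<lambda>z. g z * indicator (- N) z)"
        by (rule Bochner_Integration.integral_add; rule integrable_pmf_bounded[where M = M])
           (use g order_trans[OF abs_ge_zero g] in \<open>auto simp: indicator_def\<close>)
      finally show ?thesis using 1 by simp
    qed
    have "\<bar>measure_pmf.expectation ?p (\<lambda>z. g z * indicator (- N) z)\<bar>
        \<le> measure_pmf.expectation ?p (\<lambda>z. \<bar>g z * indicator (- N) z\<bar>)"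
      by (rule integral_abs_bound)
    also have "\<dots> \<le> measure_pmf.expectation ?p (\<lambda>z. M * indicator (- N) z)"
      by (rule integral_mono; (rule integrable_pmf_bounded[where M = M])?)
         (use g order_trans[OF abs_ge_zero g] in \<open>auto simp: indicator_def\<close>)
    also have "\<dots> = M * measure_pmf.prob ?p (- N)"
      by simp
    also have "measure_pmf.prob ?p (- N) = 1 - (\<Sum>z\<in>N. pmf ?p z)"
      using measure_pmf.prob_compl[of N ?p] fin
      by (simp add: measure_measure_pmf_finite Compl_eq_Diff_UNIV)
    finally have tail: "\<bar>measure_pmf.expectation ?p (\<lambda>z. g z * indicator (- N) z)\<bar>
        \<le> M * (1 - (\<Sum>z\<in>N. pmf ?p z))" .
    have "(\<Sum>z\<in>N. g z * of_bool (z = x)) = g x"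
      using fin xN by (simp add: of_bool_def if_distrib cong: if_cong)
    moreover have "(\<Sum>z\<in>N. q z * g z) = gen g x"
      using sum_rate_eq_gen unfolding N_def q_def .
    \<comment> \<open>The definition of \<open>e\<close> is solved for the transition
      probability.\<close>
    moreover have "(\<Sum>z\<in>N. g z * pmf ?p z) = (\<Sum>z\<in>N. s * (g z * e s z) + g z * of_bool (z = x) + s * (q z * g z))"
      using s by (intro sum.cong) (auto simp: e_def field_simps)
    ultimately have main: "(\<Sum>z\<in>N. g z * pmf ?p z) = s * (\<Sum>z\<in>N. g z * e s z) + g x + s * gen g x"
      by (simp add: sum.distrib flip: sum_distrib_left)
    have "\<bar>\<Sum>z\<in>N. g z * e s z\<bar> \<le> M * (\<Sum>z\<in>N. \<bar>e s z\<bar>)"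
      unfolding sum_distrib_left
      by (rule order_trans[OF sum_abs]) (auto intro!: sum_mono mult_right_mono g simp: abs_mult)
    then have "s * \<bar>\<Sum>z\<in>N. g z * e s z\<bar> \<le> s * (M * (\<Sum>z\<in>N. \<bar>e s z\<bar>))"
      using s by (intro mult_left_mono) auto
    then have "\<bar>s * (\<Sum>z\<in>N. g z * e s z)\<bar> \<le> s * (M * (\<Sum>z\<in>N. \<bar>e s z\<bar>))"
      using s by (simp add: abs_mult)
    moreover have "s * (M * \<delta> s) = s * (M * (\<Sum>z\<in>N. \<bar>e s z\<bar>)) + M * (1 - (\<Sum>z\<in>N. pmf ?p z))"
      using s by (simp add: \<delta>_def distrib_left)
    ultimately show ?thesis using tail main split by linarith
  qed
  show thesis by (rule that[OF lim bound])
qed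

lemma abs_trans_op_le:
  assumes "\<And>x. \<bar>f x\<bar> \<le> M"
  shows "\<bar>trans_op f t x\<bar> \<le> M"
  unfolding trans_op_def by (rule abs_expectation_pmf_le) (rule assms)

lemma trans_op_0: "trans_op f 0 x = f x"
  by (simp add: trans_op_def P_0)

lemma trans_op_add:
  assumes "\<And>x. \<bar>f x\<bar> \<le> M" "s \<ge> 0" "t \<ge> 0"
  shows "trans_op f (s + t) x = measure_pmf.expectation (P s x) (trans_op f t)"
proof -
  have "P (s + t) x = bind_pmf (P s x) (P t)"
    using transition assms by (simp add: ctmc_transition_def)
  then show ?thesis
    unfolding trans_op_def using expectation_bind_pmf_bounded[where f = f, OF assms(1)] by simp
qed

text \<open>The increment over \<open>s\<close> is that of \<open>P\<^sub>s\<close> acting on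
  \<open>trans_op f t\<close>, which is bounded by the same \<open>M\<close> for every
  \<open>t\<close>; the modulus is therefore uniform in \<open>t\<close>.\<close>

lemma continuous_on_trans_op:
  assumes f: "\<And>x. \<bar>f x\<bar> \<le> M"
  shows "continuous_on {0..} (\<lambda>t. trans_op f t x)"
proof -
  obtain \<delta> where \<delta>: "(\<delta> \<longlongrightarrow> 0) (at_right 0)"
    "\<And>s g M. s > 0 \<Longrightarrow> (\<And>z. \<bar>g z\<bar> \<le> M) \<Longrightarrow>
      \<bar>measure_pmf.expectation (P s x) g - g x - s * gen g x\<bar> \<le> s * (M * \<delta> s)"
    using generator_modulus[of x] by metis
  show ?thesis
  proof (rule continuous_on_atLeast_modulus)
    show "((\<lambda>s. s * (4 * c * M) + s * (M * \<delta> s)) \<longlongrightarrow> 0) (at_right 0)"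
      by (auto intro!: tendsto_eq_intros \<delta>(1))
    fix t s :: real assume t: "t \<ge> 0" "s > 0"
    have "\<bar>trans_op f (s + t) x - trans_op f t x - s * gen (trans_op f t) x\<bar> \<le> s * (M * \<delta> s)"
      using t by (subst trans_op_add[where f = f, OF f]) (auto intro!: \<delta>(2) abs_trans_op_le f)
    moreover have "\<bar>s * gen (trans_op f t) x\<bar> \<le> s * (4 * c * M)"
      unfolding abs_mult using t by (intro mult_mono abs_gen_le abs_trans_op_le f) auto
    ultimately show "\<bar>trans_op f (t + s) x - trans_op f t x\<bar> \<le> s * (4 * c * M) + s * (M * \<delta> s)"
      by (simp add: add.commute[of t s])
  qed
qed

text \<open>The expansion at time 0 is applied to \<open>trans_op f t\<close>, which gives a forward
  derivative with error uniform in \<open>t\<close>; continuity of the generator along the orbit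
  supplies the other side.\<close>

lemma trans_op_backward_equation:
  assumes f: "\<And>x. \<bar>f x\<bar> \<le> M" and t: "t \<ge> 0"
  shows "((\<lambda>t. trans_op f t x) has_real_derivative gen (trans_op f t) x) (at t within {0..})"
proof -
  obtain \<delta> where \<delta>: "(\<delta> \<longlongrightarrow> 0) (at_right 0)"
    "\<And>s g M. s > 0 \<Longrightarrow> (\<And>z. \<bar>g z\<bar> \<le> M) \<Longrightarrow>
      \<bar>measure_pmf.expectation (P s x) g - g x - s * gen g x\<bar> \<le> s * (M * \<delta> s)"
    using generator_modulus[of x] by metis
  show ?thesis
  proof (rule has_real_derivative_atLeast_modulus[OF _ _ _ t])
    show "((\<lambda>s. M * \<delta> s) \<longlongrightarrow> 0) (at_right 0)"
      using tendsto_mult_right_zero[OF \<delta>(1)] .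
    show "continuous_on {0..} (\<lambda>t. gen (trans_op f t) x)"
      unfolding bd_gen_def by (intro continuous_intros continuous_on_trans_op[where f = f, OF f])
    fix t s :: real assume t: "t \<ge> 0" "s > 0"
    show "\<bar>trans_op f (t + s) x - trans_op f t x - s * gen (trans_op f t) x\<bar> \<le> s * (M * \<delta> s)"
      unfolding add.commute[of t s] using t
      by (subst trans_op_add[where f = f, OF f]) (auto intro!: \<delta>(2) abs_trans_op_le f)
  qed
qed

end

section \<open>Stationarity and detailed balance\<close>

locale stationary_birth_death = birth_death_semigroup +
  fixes \<nu> :: "nat pmf"
  assumes stationary: "ctmc_stationary P \<nu>"
begin

lemma expectation_trans_op:
  assumes "\<And>x. \<bar>f x\<bar> \<le> M" "t \<ge> 0"
  shows "measure_pmf.expectation \<nu> (trans_op f t) = measure_pmf.expectation \<nu> f"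
proof -
  have "bind_pmf \<nu> (P t) = \<nu>"
    using stationary assms by (simp add: ctmc_stationary_def ctmc_law_def)
  then show ?thesis
    unfolding trans_op_def using expectation_bind_pmf_bounded[where f = f, OF assms(1), of \<nu> "P t"] by simp
qed

text \<open>The mean of \<open>trans_op f t\<close> under \<open>\<nu>\<close> is constant in
  \<open>t\<close>; its derivative at 0 is computed under the expectation.\<close>

lemma expectation_gen_eq_0:
  assumes f: "\<And>x. \<bar>f x\<bar> \<le> M"
  shows "measure_pmf.expectation \<nu> (gen f) = 0"
proof -
  have "((\<lambda>t. measure_pmf.expectation \<nu> (trans_op f t)) has_real_derivative
      measure_pmf.expectation \<nu> (gen (trans_op f 0))) (at 0 within {0..})"
    by (rule expectation_pmf_has_derivative[where M = M and M' = "4 * c * M" and F' = "\<lambda>t. gen (trans_op f t)"])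
       (auto intro!: trans_op_backward_equation abs_trans_op_le abs_gen_le f)
  moreover have "((\<lambda>t. measure_pmf.expectation \<nu> (trans_op f t)) has_real_derivative 0) (at 0 within {0..})"
    by (rule has_field_derivative_transform_within[where d = 1, OF DERIV_const[of "measure_pmf.expectation \<nu> f"]])
       (use expectation_trans_op[OF f] in auto)
  moreover have "at (0::real) within {0..} \<noteq> bot"
  proof -
    have "{0..} - {0::real} = {0<..}" by auto
    then show ?thesis by (simp add: at_within_eq_bot_iff)
  qed
  ultimately have "measure_pmf.expectation \<nu> (gen (trans_op f 0)) = 0"
    using has_field_derivative_unique by blast
  then show ?thesis by (simp add: trans_op_0[abs_def])
qed

text \<open>The generator of the indicator of \<open>{0..i}\<close> lives on \<open>i\<close> and
  \<open>Suc i\<close> only, so its mean is the net flux across this cut, which is zero in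
  stationarity.\<close>

lemma detailed_balance: "pmf \<nu> i * b i = pmf \<nu> (Suc i) * d (Suc i)"
proof -
  let ?f = "\<lambda>x. of_bool (x \<le> i) :: real"
  have gen: "gen ?f = (\<lambda>x. d (Suc i) * indicator {Suc i} x - b i * indicator {i} x)"
    by (rule ext) (auto simp: bd_gen_def indicator_def d_0)
  have "measure_pmf.expectation \<nu> (gen ?f) = (\<Sum>x\<in>{i, Suc i}. gen ?f x * pmf \<nu> x)"
    unfolding gen by (rule integral_measure_pmf_real) (auto simp: indicator_def split: if_splits)
  moreover have "measure_pmf.expectation \<nu> (gen ?f) = 0"
    by (rule expectation_gen_eq_0[where M = 1]) auto
  ultimately show ?thesis
    unfolding gen by (simp add: mult.commute)
qed

end

section \<open>Weighted Hardy inequality, Poincare inequality and variance decay\<close>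

text \<open>The right side minus the left side equals
  \<open>(\<theta> * a - b)\<^sup>2 / \<theta>\<close>.\<close>

lemma add_square_weighted_le:
  fixes a b \<theta> :: real
  assumes "\<theta> > 0"
  shows "a\<^sup>2 * (1 - \<theta>) + b\<^sup>2 * (1 - 1 / \<theta>) \<le> (a - b)\<^sup>2"
proof -
  have "0 \<le> (\<theta> * a - b)\<^sup>2 / \<theta>" using assms by simp
  also have "\<dots> = \<theta> * a\<^sup>2 - 2 * a * b + b\<^sup>2 / \<theta>"
    using assms by (simp add: power2_eq_square field_simps)
  finally show ?thesis by (simp add: power2_eq_square algebra_simps)
qed

text \<open>The weight \<open>\<theta> i\<close> splits the increment \<open>\<nu> i * f i\<close>
  of the partial sums between its two end points. The right side of \<open>gap\<close> is the
  coefficient that the increments at \<open>i\<close> and \<open>Suc i\<close> leave on the partial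
  sum at \<open>i\<close>, in units of \<open>1 / (\<nu> i * b i)\<close>. The value
  \<open>\<theta> 0 = 0\<close> fits the empty sum before state 0.\<close>

locale birth_death_hardy =
  fixes b d \<nu> \<theta> :: "nat \<Rightarrow> real" and \<gamma> :: real
  assumes balance: "\<nu> i * b i = \<nu> (Suc i) * d (Suc i)"
    and b_pos: "0 < b i" and d_pos: "0 < d (Suc i)" and d_0: "d 0 = 0"
    and \<nu>_pos: "0 < \<nu> i"
    and \<theta>_0: "\<theta> 0 = 0" and \<theta>_pos: "0 < \<theta> (Suc i)"
    and \<gamma>_pos: "0 < \<gamma>"
    and gap: "\<gamma> \<le> b i * (1 - \<theta> i) + d (Suc i) * (1 - 1 / \<theta> (Suc i))"
begin

text \<open>Induction carries the share that increment \<open>N\<close> gives to its right end point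
  as a boundary term; the share from increment \<open>Suc N\<close> completes it, and
  \<open>balance\<close> puts both over the same denominator.\<close>

lemma hardy:
  fixes f :: "nat \<Rightarrow> real"
  defines "G \<equiv> \<lambda>i. \<Sum>j\<le>i. \<nu> j * f j"
  shows "\<gamma> * (\<Sum>i<N. (G i)\<^sup>2 / (\<nu> i * b i)) + (G N)\<^sup>2 * (1 - \<theta> N) / \<nu> N \<le> (\<Sum>i\<le>N. \<nu> i * (f i)\<^sup>2)"
proof (induction N)
  case 0
  show ?case using \<nu>_pos[of 0] by (simp add: G_def \<theta>_0 power2_eq_square)
next
  case (Suc N)
  have c: "0 < \<nu> N * b N" using \<nu>_pos b_pos by simp
  have "\<gamma> / (\<nu> N * b N) \<le> (b N * (1 - \<theta> N) + d (Suc N) * (1 - 1 / \<theta> (Suc N))) / (\<nu> N * b N)"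
    using gap c by (intro divide_right_mono) auto
  also have "\<dots> = b N * (1 - \<theta> N) / (\<nu> N * b N) + d (Suc N) * (1 - 1 / \<theta> (Suc N)) / (\<nu> (Suc N) * d (Suc N))"
    by (simp add: balance add_divide_distrib)
  also have "\<dots> = (1 - \<theta> N) / \<nu> N + (1 - 1 / \<theta> (Suc N)) / \<nu> (Suc N)"
    using b_pos[of N] d_pos[of N] by simp
  finally have "(G N)\<^sup>2 * (\<gamma> / (\<nu> N * b N)) \<le> (G N)\<^sup>2 * ((1 - \<theta> N) / \<nu> N + (1 - 1 / \<theta> (Suc N)) / \<nu> (Suc N))"
    by (rule mult_left_mono) simp
  then have 1: "\<gamma> * ((G N)\<^sup>2 / (\<nu> N * b N))
      \<le> (G N)\<^sup>2 * (1 - \<theta> N) / \<nu> N + (G N)\<^sup>2 * (1 - 1 / \<theta> (Suc N)) / \<nu> (Suc N)"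
    by (simp add: distrib_left mult.commute)
  have "((G (Suc N))\<^sup>2 * (1 - \<theta> (Suc N)) + (G N)\<^sup>2 * (1 - 1 / \<theta> (Suc N))) / \<nu> (Suc N)
      \<le> (G (Suc N) - G N)\<^sup>2 / \<nu> (Suc N)"
    using add_square_weighted_le[OF \<theta>_pos] \<nu>_pos by (intro divide_right_mono) (auto intro: less_imp_le)
  also have "\<dots> = \<nu> (Suc N) * (f (Suc N))\<^sup>2"
    using \<nu>_pos[of "Suc N"] by (simp add: G_def power2_eq_square)
  finally have 2: "(G (Suc N))\<^sup>2 * (1 - \<theta> (Suc N)) / \<nu> (Suc N) + (G N)\<^sup>2 * (1 - 1 / \<theta> (Suc N)) / \<nu> (Suc N)
      \<le> \<nu> (Suc N) * (f (Suc N))\<^sup>2"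
    by (simp add: add_divide_distrib)
  show ?case using Suc.IH 1 2 by (simp add: distrib_left)
qed

text \<open>Discrete Green formula: \<open>balance\<close> pairs the death flux from
  \<open>Suc i\<close> with the birth flux from \<open>i\<close>, leaving the Dirichlet form and a
  flux through the edge at \<open>N\<close>.\<close>

lemma gen_summation_by_parts:
  "(\<Sum>i\<le>N. \<nu> i * (f i * bd_gen b d f i))
     = f N * (\<nu> N * b N * (f (Suc N) - f N)) - (\<Sum>i<N. \<nu> i * b i * (f (Suc i) - f i)\<^sup>2)"
proof (induction N)
  case 0
  show ?case by (simp add: bd_gen_def d_0)
next
  case (Suc N)
  have "\<nu> (Suc N) * (f (Suc N) * bd_gen b d f (Suc N))
      = f (Suc N) * (\<nu> (Suc N) * b (Suc N) * (f (Suc (Suc N)) - f (Suc N)))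
        - f (Suc N) * ((\<nu> (Suc N) * d (Suc N)) * (f (Suc N) - f N))"
    by (simp add: bd_gen_def algebra_simps)
  then show ?case
    using Suc.IH by (simp flip: balance) (simp add: algebra_simps power2_eq_square)
qed

lemma square_summation_by_parts:
  fixes f :: "nat \<Rightarrow> real"
  defines "G \<equiv> \<lambda>i. \<Sum>j\<le>i. \<nu> j * f j"
  shows "(\<Sum>i\<le>N. \<nu> i * (f i)\<^sup>2) = f N * G N - (\<Sum>i<N. G i * (f (Suc i) - f i))"
  by (induction N) (auto simp: G_def algebra_simps power2_eq_square)

text \<open>Abel summation expresses \<open>2 * \<gamma>\<close> times the second moment through
  products of partial sums and increments of \<open>f\<close>. Completing the square splits each
  product; the Hardy inequality absorbs the partial sums into one copy of the second moment, and the
  increments form the Dirichlet form.\<close>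

lemma poincare_partial_sums:
  fixes f :: "nat \<Rightarrow> real" and N :: nat
  defines "G \<equiv> \<Sum>j\<le>N. \<nu> j * f j"
  shows "\<gamma> * (\<Sum>i\<le>N. \<nu> i * (f i)\<^sup>2) \<le> - (\<Sum>i\<le>N. \<nu> i * (f i * bd_gen b d f i))
    + (2 * \<gamma> * (f N * G) - \<gamma> * (G\<^sup>2 * (1 - \<theta> N) / \<nu> N) + f N * (\<nu> N * b N * (f (Suc N) - f N)))"
proof -
  define H where "H i = (\<Sum>j\<le>i. \<nu> j * f j)" for i
  have "- (2 * \<gamma> * (H i * (f (Suc i) - f i)))
      \<le> \<gamma> * (\<gamma> * ((H i)\<^sup>2 / (\<nu> i * b i))) + \<nu> i * b i * (f (Suc i) - f i)\<^sup>2" for i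
  proof -
    let ?c = "\<nu> i * b i"
    have c: "?c > 0" using \<nu>_pos b_pos by simp
    have "0 \<le> (\<gamma> * H i + ?c * (f (Suc i) - f i))\<^sup>2 / ?c" using c by simp
    also have "\<dots> = \<gamma> * (\<gamma> * ((H i)\<^sup>2 / ?c)) + 2 * \<gamma> * (H i * (f (Suc i) - f i)) + ?c * (f (Suc i) - f i)\<^sup>2"
    proof -
      have "(\<gamma> * h + c * g)\<^sup>2 / c = \<gamma> * (\<gamma> * (h\<^sup>2 / c)) + 2 * \<gamma> * (h * g) + c * g\<^sup>2"
        if "c > 0" for c g h :: real
        using that by (simp add: power2_eq_square field_simps)
      from this[OF c] show ?thesis .
    qed
    finally show ?thesis by linarith
  qed
  then have "(\<Sum>i<N. - (2 * \<gamma> * (H i * (f (Suc i) - f i))))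
      \<le> (\<Sum>i<N. \<gamma> * (\<gamma> * ((H i)\<^sup>2 / (\<nu> i * b i))) + \<nu> i * b i * (f (Suc i) - f i)\<^sup>2)"
    by (rule sum_mono)
  then have 1: "- (2 * \<gamma> * (\<Sum>i<N. H i * (f (Suc i) - f i)))
      \<le> \<gamma> * (\<gamma> * (\<Sum>i<N. (H i)\<^sup>2 / (\<nu> i * b i))) + (\<Sum>i<N. \<nu> i * b i * (f (Suc i) - f i)\<^sup>2)"
    by (simp add: sum.distrib sum_distrib_left sum_negf)
  have "\<gamma> * (\<gamma> * (\<Sum>i<N. (H i)\<^sup>2 / (\<nu> i * b i)) + (H N)\<^sup>2 * (1 - \<theta> N) / \<nu> N)
      \<le> \<gamma> * (\<Sum>i\<le>N. \<nu> i * (f i)\<^sup>2)"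
    using hardy[of f N] \<gamma>_pos unfolding H_def by (intro mult_left_mono) auto
  then have 2: "\<gamma> * (\<gamma> * (\<Sum>i<N. (H i)\<^sup>2 / (\<nu> i * b i))) + \<gamma> * ((H N)\<^sup>2 * (1 - \<theta> N) / \<nu> N)
      \<le> \<gamma> * (\<Sum>i\<le>N. \<nu> i * (f i)\<^sup>2)"
    by (simp only: distrib_left)
  have 3: "2 * \<gamma> * (\<Sum>i\<le>N. \<nu> i * (f i)\<^sup>2)
      = 2 * \<gamma> * (f N * H N) - 2 * \<gamma> * (\<Sum>i<N. H i * (f (Suc i) - f i))"
    unfolding square_summation_by_parts H_def by (simp only: right_diff_distrib)
  have "G = H N" by (simp add: G_def H_def)
  then show ?thesis using 1 2 3 gen_summation_by_parts[where N = N and f = f] by simp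
qed

end

text \<open>The geometric decay of \<open>\<nu>\<close> is what kills the boundary terms at \<open>N\<close> in
  \<open>birth_death_hardy.poincare_partial_sums\<close>: it makes the partial sums of \<open>\<nu> f\<close> of order \<open>\<nu> N\<close>.\<close>

locale gapped_birth_death = stationary_birth_death +
  fixes \<theta> :: "nat \<Rightarrow> real" and \<gamma> \<Theta> \<rho> :: real and n :: nat
  assumes b_pos: "0 < b i" and d_pos: "0 < d (Suc i)"
    and \<theta>_0: "\<theta> 0 = 0" and \<theta>_pos: "0 < \<theta> (Suc i)" and \<theta>_le: "\<theta> i \<le> \<Theta>"
    and \<gamma>_pos: "0 < \<gamma>"
    and gap: "\<gamma> \<le> b i * (1 - \<theta> i) + d (Suc i) * (1 - 1 / \<theta> (Suc i))"
    and \<rho>: "0 < \<rho>" "\<rho> < 1"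
    and geometric: "i \<ge> n \<Longrightarrow> b i \<le> \<rho> * d (Suc i)"
begin

text \<open>With positive rates, detailed balance carries a zero of \<open>\<nu>\<close> to every
  state, which is impossible for a probability.\<close>

lemma pmf_\<nu>_pos: "0 < pmf \<nu> i"
proof (rule ccontr)
  assume "\<not> ?thesis"
  then have i: "pmf \<nu> i = 0" using pmf_nonneg[of \<nu> i] by simp
  have iff: "pmf \<nu> (Suc j) = 0 \<longleftrightarrow> pmf \<nu> j = 0" for j
    using detailed_balance[of j] b_pos[of j] d_pos[of j] by (metis less_irrefl mult_eq_0_iff)
  have "pmf \<nu> j = 0 \<longleftrightarrow> pmf \<nu> 0 = 0" for j by (induction j) (auto simp: iff)
  then have "pmf \<nu> j = 0" for j using i by metis
  then have "set_pmf \<nu> = {}" by (auto simp: set_pmf_iff)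
  then show False by (simp add: set_pmf_not_empty)
qed

sublocale hardy: birth_death_hardy b d "pmf \<nu>" \<theta> \<gamma>
  by unfold_locales
     (use detailed_balance b_pos d_pos d_0 pmf_\<nu>_pos \<theta>_0 \<theta>_pos \<gamma>_pos gap in auto)

lemma pmf_\<nu>_geometric: "i \<ge> n \<Longrightarrow> pmf \<nu> (i + k) \<le> pmf \<nu> i * \<rho> ^ k"
proof (induction k)
  case (Suc k)
  have "pmf \<nu> (Suc (i + k)) * d (Suc (i + k)) \<le> pmf \<nu> (i + k) * (\<rho> * d (Suc (i + k)))"
    using geometric[of "i + k"] Suc.prems by (subst detailed_balance[symmetric]) (auto intro!: mult_left_mono)
  then have "pmf \<nu> (Suc (i + k)) \<le> \<rho> * pmf \<nu> (i + k)"
    using d_pos[of "i + k"] by (simp add: mult.commute mult.left_commute)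
  also have "\<dots> \<le> \<rho> * (pmf \<nu> i * \<rho> ^ k)"
    using Suc \<rho> by (intro mult_left_mono) auto
  finally show ?case by (simp add: mult_ac)
qed simp

text \<open>Mean zero turns the partial sum into minus the tail after \<open>N\<close>, which a
  geometric series dominates.\<close>

lemma abs_partial_sum_le:
  assumes f: "\<And>x. \<bar>f x\<bar> \<le> M" and mean: "measure_pmf.expectation \<nu> f = 0" and N: "N \<ge> n"
  shows "\<bar>\<Sum>j\<le>N. pmf \<nu> j * f j\<bar> \<le> pmf \<nu> N * (M / (1 - \<rho>))"
proof -
  have M: "0 \<le> M" using order_trans[OF abs_ge_zero f] .
  have "(\<lambda>j. pmf \<nu> j * f j) sums 0"
    using expectation_pmf_sums[where f = f and p = \<nu>, OF f] mean by simp
  then have "(\<lambda>k. pmf \<nu> (k + Suc N) * f (k + Suc N)) sums (0 - (\<Sum>j<Suc N. pmf \<nu> j * f j))"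
    by (rule sums_split_initial_segment)
  then have tail: "(\<lambda>k. pmf \<nu> (k + Suc N) * f (k + Suc N)) sums (- (\<Sum>j\<le>N. pmf \<nu> j * f j))"
    by (simp add: lessThan_Suc_atMost)
  have geo: "(\<lambda>k. (pmf \<nu> N * M) * \<rho> ^ k) sums ((pmf \<nu> N * M) * (1 / (1 - \<rho>)))"
    using \<rho> by (intro sums_mult geometric_sums) auto
  have le: "norm (pmf \<nu> (k + Suc N) * f (k + Suc N)) \<le> (pmf \<nu> N * M) * \<rho> ^ k" for k
  proof -
    have "pmf \<nu> (k + Suc N) \<le> pmf \<nu> N * \<rho> ^ Suc k"
      using pmf_\<nu>_geometric[OF N, of "Suc k"] by (simp add: add.commute)
    also have "\<dots> \<le> pmf \<nu> N * \<rho> ^ k"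
      using \<rho> by (intro mult_left_mono power_decreasing) auto
    finally have "\<bar>pmf \<nu> (k + Suc N)\<bar> * \<bar>f (k + Suc N)\<bar> \<le> (pmf \<nu> N * \<rho> ^ k) * M"
      using f \<rho> by (intro mult_mono) auto
    then show ?thesis by (simp add: abs_mult mult_ac)
  qed
  have "norm (- (\<Sum>j\<le>N. pmf \<nu> j * f j)) \<le> (pmf \<nu> N * M) * (1 / (1 - \<rho>))"
    by (rule norm_sums_le[OF tail geo le])
  then show ?thesis by (simp add: mult.assoc)
qed

lemma pmf_\<nu>_tendsto_0: "pmf \<nu> \<longlonglongrightarrow> 0"
  using summable_LIMSEQ_zero[OF sums_summable[OF expectation_pmf_sums[of "\<lambda>_. 1" 1 \<nu>]]] by simp

text \<open>The limit of the truncated inequality: all boundary terms together are at most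
  \<open>pmf \<nu> N * R\<close>, which tends to 0.\<close>

lemma poincare:
  assumes f: "\<And>x. \<bar>f x\<bar> \<le> M" and mean: "measure_pmf.expectation \<nu> f = 0"
  shows "\<gamma> * measure_pmf.expectation \<nu> (\<lambda>x. (f x)\<^sup>2)
    \<le> - measure_pmf.expectation \<nu> (\<lambda>x. f x * gen f x)"
proof -
  let ?S = "\<lambda>N. \<Sum>i\<le>N. pmf \<nu> i * (f i)\<^sup>2"
  let ?W = "\<lambda>N. \<Sum>i\<le>N. pmf \<nu> i * (f i * gen f i)"
  let ?G = "\<lambda>N. \<Sum>j\<le>N. pmf \<nu> j * f j"
  define K where "K = M / (1 - \<rho>)"
  have M: "0 \<le> M" using order_trans[OF abs_ge_zero f] .
  have c: "0 \<le> c" using order_trans[OF b_nonneg b_le] .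
  have K: "0 \<le> K" using M \<rho> by (simp add: K_def)
  have sq: "\<bar>(f x)\<^sup>2\<bar> \<le> M\<^sup>2" for x
    using power_mono[OF f[of x] abs_ge_zero, of 2] by simp
  have fgen: "\<bar>f x * gen f x\<bar> \<le> M * (4 * c * M)" for x
    unfolding abs_mult using f M by (intro mult_mono abs_gen_le) auto
  have S: "?S \<longlonglongrightarrow> measure_pmf.expectation \<nu> (\<lambda>x. (f x)\<^sup>2)"
    using expectation_pmf_sums[where f = "\<lambda>x. (f x)\<^sup>2", OF sq] unfolding sums_def_le .
  have W: "?W \<longlonglongrightarrow> measure_pmf.expectation \<nu> (\<lambda>x. f x * gen f x)"
    using expectation_pmf_sums[where f = "\<lambda>x. f x * gen f x", OF fgen] unfolding sums_def_le .
  \<comment> \<open>One summand for each boundary term, using that partial sums are at most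
    \<open>K * pmf \<nu> N\<close>; in the middle term the square contributes two factors
    \<open>pmf \<nu> N\<close> and the denominator cancels one.\<close>
  define R where "R = 2 * \<gamma> * (M * K) + \<gamma> * (K\<^sup>2 * (1 + \<Theta>)) + M * (c * (2 * M))"
  have bound: "\<gamma> * ?S N \<le> - ?W N + pmf \<nu> N * R" if N: "N \<ge> n" for N
  proof -
    let ?p = "pmf \<nu> N"
    have G: "\<bar>?G N\<bar> \<le> ?p * K"
      unfolding K_def by (rule abs_partial_sum_le[where f = f, OF f mean N])
    have p: "0 < ?p" by (rule pmf_\<nu>_pos)
    have "f N * ?G N \<le> \<bar>f N\<bar> * \<bar>?G N\<bar>" by (metis abs_ge_self abs_mult)
    also have "\<dots> \<le> M * (?p * K)" by (intro mult_mono f G M) auto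
    finally have 1: "2 * \<gamma> * (f N * ?G N) \<le> 2 * \<gamma> * (M * (?p * K))"
      using \<gamma>_pos by (intro mult_left_mono) auto
    have \<theta>: "0 \<le> \<theta> N" using \<theta>_0 \<theta>_pos by (cases N) (auto intro: less_imp_le)
    have "(?G N)\<^sup>2 \<le> (?p * K)\<^sup>2" using power_mono[OF G abs_ge_zero, of 2] by simp
    then have "(?G N)\<^sup>2 * (\<theta> N - 1) / ?p \<le> (?p * K)\<^sup>2 * (1 + \<Theta>) / ?p"
    proof -
      have "(?G N)\<^sup>2 * (\<theta> N - 1) \<le> (?G N)\<^sup>2 * (1 + \<Theta>)"
        using \<theta>_le[of N] by (intro mult_left_mono) auto
      also have "\<dots> \<le> (?p * K)\<^sup>2 * (1 + \<Theta>)"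
        using \<open>(?G N)\<^sup>2 \<le> (?p * K)\<^sup>2\<close> \<theta> \<theta>_le[of N] by (intro mult_right_mono) auto
      finally show ?thesis using p by (intro divide_right_mono) auto
    qed
    also have "\<dots> = ?p * (K\<^sup>2 * (1 + \<Theta>))"
      using p by (simp add: power2_eq_square)
    finally have "\<gamma> * ((?G N)\<^sup>2 * (\<theta> N - 1) / ?p) \<le> \<gamma> * (?p * (K\<^sup>2 * (1 + \<Theta>)))"
      using \<gamma>_pos by (intro mult_left_mono) auto
    moreover have "(?G N)\<^sup>2 * (\<theta> N - 1) / ?p = - ((?G N)\<^sup>2 * (1 - \<theta> N) / ?p)"
      by (simp add: algebra_simps diff_divide_distrib)
    ultimately have 2: "- (\<gamma> * ((?G N)\<^sup>2 * (1 - \<theta> N) / ?p)) \<le> \<gamma> * (?p * (K\<^sup>2 * (1 + \<Theta>)))"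
      by simp
    have "f N * (?p * b N * (f (Suc N) - f N)) \<le> \<bar>f N\<bar> * (?p * b N * \<bar>f (Suc N) - f N\<bar>)"
      using abs_ge_self[of "f N * (?p * b N * (f (Suc N) - f N))"] p b_nonneg[of N] by (simp add: abs_mult)
    also have "\<dots> \<le> M * (?p * c * (2 * M))"
      using f[of N] f[of "Suc N"] M p c b_nonneg b_le by (intro mult_mono) auto
    finally have 3: "f N * (?p * b N * (f (Suc N) - f N)) \<le> M * (?p * c * (2 * M))" .
    have "?p * R = 2 * \<gamma> * (M * (?p * K)) + \<gamma> * (?p * (K\<^sup>2 * (1 + \<Theta>))) + M * (?p * c * (2 * M))"
      by (simp add: R_def algebra_simps)
    then show ?thesis using hardy.poincare_partial_sums[of f N] 1 2 3 by linarith
  qed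
  have rhs: "(\<lambda>N. - ?W N + pmf \<nu> N * R) \<longlonglongrightarrow> - measure_pmf.expectation \<nu> (\<lambda>x. f x * gen f x)"
    using tendsto_add[OF tendsto_minus[OF W] tendsto_mult_left_zero[OF pmf_\<nu>_tendsto_0, of R]] by simp
  show ?thesis
    by (rule LIMSEQ_le[OF tendsto_mult_left[OF S] rhs]) (use bound in blast)
qed

text \<open>Centring leaves the generator unchanged, so the Poincare inequality for the centred
  function gives \<open>V' \<le> - 2 * \<gamma> * V\<close>.\<close>

lemma variance_decay:
  assumes f: "\<And>x. \<bar>f x\<bar> \<le> M" and t: "t \<ge> 0"
  defines "m \<equiv> measure_pmf.expectation \<nu> f"
  shows "measure_pmf.expectation \<nu> (\<lambda>x. (trans_op f t x - m)\<^sup>2)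
    \<le> exp (- 2 * \<gamma> * t) * measure_pmf.expectation \<nu> (\<lambda>x. (f x - m)\<^sup>2)"
proof -
  define V where "V t = measure_pmf.expectation \<nu> (\<lambda>x. (trans_op f t x - m)\<^sup>2)" for t
  define V' where "V' t = measure_pmf.expectation \<nu> (\<lambda>x. 2 * ((trans_op f t x - m) * gen (trans_op f t) x))" for t
  have M: "0 \<le> M" using order_trans[OF abs_ge_zero f] .
  have m: "\<bar>m\<bar> \<le> M" unfolding m_def by (rule abs_expectation_pmf_le[where f = f, OF f])
  have um: "\<bar>trans_op f t x - m\<bar> \<le> 2 * M" for t x
    using abs_trans_op_le[where f = f and t = t and x = x, OF f] m by linarith
  have V: "(V has_real_derivative V' t) (at t within {0..})" if t: "t \<ge> 0" for t
    unfolding V_def[abs_def] V'_def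
  proof (rule expectation_pmf_has_derivative[where M = "(2 * M)\<^sup>2" and M' = "2 * ((2 * M) * (4 * c * M))", OF _ _ _ t])
    show "((\<lambda>t. (trans_op f t x - m)\<^sup>2) has_real_derivative
        2 * ((trans_op f t x - m) * gen (trans_op f t) x)) (at t within {0..})" if "t \<ge> 0" for x t
      by (auto intro!: derivative_eq_intros trans_op_backward_equation[where f = f, OF f that])
    show "\<bar>(trans_op f t x - m)\<^sup>2\<bar> \<le> (2 * M)\<^sup>2" for x t
      using power_mono[OF um[of t x] abs_ge_zero, of 2] by simp
    show "\<bar>2 * ((trans_op f t x - m) * gen (trans_op f t) x)\<bar> \<le> 2 * ((2 * M) * (4 * c * M))" for x t
    proof -
      have "\<bar>(trans_op f t x - m) * gen (trans_op f t) x\<bar> \<le> (2 * M) * (4 * c * M)"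
        unfolding abs_mult using M by (intro mult_mono um abs_gen_le abs_trans_op_le f) auto
      then show ?thesis by simp
    qed
  qed
  have V': "V' t \<le> - 2 * \<gamma> * V t" if t: "t \<ge> 0" for t
  proof -
    have "measure_pmf.expectation \<nu> (\<lambda>x. trans_op f t x - m) = 0"
      using expectation_trans_op[where f = f, OF f t]
      by (subst Bochner_Integration.integral_diff)
         (auto simp: m_def intro!: integrable_pmf_bounded abs_trans_op_le f)
    from poincare[where f = "\<lambda>x. trans_op f t x - m", OF um this] show ?thesis
      by (simp add: V_def V'_def bd_gen_diff_const)
  qed
  \<comment> \<open>Gronwall argument: the derivative is taken at interior times, where the
    derivative within \<open>{0..}\<close> is two-sided; continuity covers the end points.\<close>
  have "exp (2 * \<gamma> * t) * V t \<le> exp (2 * \<gamma> * 0) * V 0"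
  proof (rule DERIV_nonpos_imp_decreasing_open[OF t])
    fix s assume s: "0 < s" "s < t"
    have "at s within {0..} = at s" using s by (intro at_within_interior) auto
    then have "(V has_real_derivative V' s) (at s)" using V[of s] s by simp
    then have "((\<lambda>t. exp (2 * \<gamma> * t) * V t) has_real_derivative
        exp (2 * \<gamma> * s) * (2 * \<gamma> * V s + V' s)) (at s)"
      by (auto intro!: derivative_eq_intros simp: algebra_simps)
    moreover have "exp (2 * \<gamma> * s) * (2 * \<gamma> * V s + V' s) \<le> 0"
      using V'[of s] s by (intro mult_nonneg_nonpos) auto
    ultimately show "\<exists>y. ((\<lambda>t. exp (2 * \<gamma> * t) * V t) has_real_derivative y) (at s) \<and> y \<le> 0"
      by blast
  next
    have "continuous_on {0..} V"
      using V by (intro DERIV_continuous_on) auto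
    then have "continuous_on {0..t} V"
      by (rule continuous_on_subset) auto
    then show "continuous_on {0..t} (\<lambda>t. exp (2 * \<gamma> * t) * V t)"
      by (intro continuous_intros)
  qed
  then have "exp (- 2 * \<gamma> * t) * (exp (2 * \<gamma> * t) * V t) \<le> exp (- 2 * \<gamma> * t) * V 0"
    by (intro mult_left_mono) auto
  then show ?thesis
    by (simp add: V_def trans_op_0 mult.assoc[symmetric] flip: exp_add)
qed

end

section \<open>Contraction of the chi distance by duality\<close>

lemma chi_sq_dist_eq_suminf:
  fixes p q :: "nat pmf"
  assumes "\<And>x. 0 < pmf q x"
  shows "chi_sq_dist p q = (\<Sum>x. ennreal ((pmf p x - pmf q x)\<^sup>2 / pmf q x))"
  unfolding chi_sq_dist_def by (simp add: nn_integral_count_space_nat divide_ennreal assms)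

lemma chi_dist_le_of_chi_sq_dist_le:
  assumes fin: "chi_sq_dist p q \<noteq> \<infinity>" and k: "0 \<le> k"
    and le: "chi_sq_dist p' q' \<le> ennreal (k\<^sup>2) * chi_sq_dist p q"
  shows "chi_dist p' q' \<le> ennreal k * chi_dist p q"
proof -
  obtain X where X: "chi_sq_dist p q = ennreal X" "X \<ge> 0"
    using fin by (cases "chi_sq_dist p q") auto
  have le': "chi_sq_dist p' q' \<le> ennreal (k\<^sup>2 * X)"
    using le X by (simp add: ennreal_mult)
  then obtain Y where Y: "chi_sq_dist p' q' = ennreal Y" "Y \<ge> 0"
    by (cases "chi_sq_dist p' q'") (auto simp: top_unique)
  have "Y \<le> k\<^sup>2 * X" using le' Y X by (simp add: ennreal_le_iff)
  then have "sqrt Y \<le> k * sqrt X"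
    using k real_sqrt_le_mono[of Y "k\<^sup>2 * X"] by (simp add: real_sqrt_mult)
  then show ?thesis
    using X Y k by (simp add: chi_dist_def ennreal_leI flip: ennreal_mult)
qed

context gapped_birth_death
begin

text \<open>Duality: testing \<open>\<pi>\<^sub>t - \<nu>\<close> against its own truncated density \<open>f\<close> gives
  \<open>\<parallel>f\<parallel>\<^sup>2 = \<langle>\<pi>\<^sub>0 - \<nu>, P\<^sub>t f - \<nu>(f)\<rangle>\<close>, and the variance of \<open>P\<^sub>t f\<close> decays.\<close>

lemma chi_sq_partial_sum_le:
  assumes sm: "summable (\<lambda>x. (pmf \<pi> x - pmf \<nu> x)\<^sup>2 / pmf \<nu> x)" and t: "t \<ge> 0"
  shows "(\<Sum>x<N. (pmf (ctmc_law P \<pi> t) x - pmf \<nu> x)\<^sup>2 / pmf \<nu> x)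
    \<le> (exp (- \<gamma> * t))\<^sup>2 * (\<Sum>x. (pmf \<pi> x - pmf \<nu> x)\<^sup>2 / pmf \<nu> x)"
proof -
  define \<pi>t where "\<pi>t = ctmc_law P \<pi> t"
  define \<kappa> where "\<kappa> = (exp (- \<gamma> * t))\<^sup>2"
  define f where "f x = (if x < N then (pmf \<pi>t x - pmf \<nu> x) / pmf \<nu> x else 0)" for x
  define S where "S = (\<Sum>x<N. (pmf \<pi>t x - pmf \<nu> x)\<^sup>2 / pmf \<nu> x)"
  define m where "m = measure_pmf.expectation \<nu> f"
  define u where "u x = trans_op f t x - m" for x
  define V where "V = measure_pmf.expectation \<nu> (\<lambda>x. (u x)\<^sup>2)"
  define X where "X = (\<Sum>x. (pmf \<pi> x - pmf \<nu> x)\<^sup>2 / pmf \<nu> x)"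
  have \<kappa>: "\<kappa> > 0" by (simp add: \<kappa>_def)
  define M where "M = (\<Sum>x<N. \<bar>f x\<bar>)"
  have f: "\<bar>f x\<bar> \<le> M" for x
  proof (cases "x < N")
    case True
    then show ?thesis unfolding M_def by (intro member_le_sum) auto
  qed (auto simp: f_def M_def intro!: sum_nonneg)
  have m: "\<bar>m\<bar> \<le> M"
    unfolding m_def by (rule abs_expectation_pmf_le[where f = f, OF f])
  have u: "\<bar>u x\<bar> \<le> 2 * M" for x
    using abs_trans_op_le[where f = f and t = t and x = x, OF f] m by (auto simp: u_def)
  have exp_finite: "measure_pmf.expectation p g = (\<Sum>x<N. g x * pmf p x)"
    if "\<And>x. x \<ge> N \<Longrightarrow> g x = 0" for g :: "nat \<Rightarrow> real" and p
    by (rule integral_measure_pmf_real) (use that in \<open>auto simp: not_le[symmetric]\<close>)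
  have S_eq: "S = measure_pmf.expectation \<pi>t f - m"
  proof -
    have "measure_pmf.expectation \<pi>t f - m = (\<Sum>x<N. f x * (pmf \<pi>t x - pmf \<nu> x))"
      unfolding m_def by (subst (1 2) exp_finite) (auto simp: f_def sum_subtractf right_diff_distrib)
    also have "\<dots> = S"
      unfolding S_def by (intro sum.cong) (auto simp: f_def power2_eq_square)
    finally show ?thesis by simp
  qed
  \<comment> \<open>The variance of \<open>f\<close> is at most its second moment, and that moment
    under \<open>\<nu>\<close> is again \<open>S\<close>.\<close>
  have "V \<le> \<kappa> * S"
  proof -
    have "V \<le> exp (- 2 * \<gamma> * t) * measure_pmf.expectation \<nu> (\<lambda>x. (f x - m)\<^sup>2)"
      unfolding V_def u_def m_def by (rule variance_decay[where f = f, OF f t])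
    also have "exp (- 2 * \<gamma> * t) = \<kappa>"
      by (simp add: \<kappa>_def power2_eq_square flip: exp_add)
    also have "measure_pmf.expectation \<nu> (\<lambda>x. (f x - m)\<^sup>2) \<le> measure_pmf.expectation \<nu> (\<lambda>x. (f x)\<^sup>2)"
    proof -
      have int: "integrable (measure_pmf \<nu>) f" "integrable (measure_pmf \<nu>) (\<lambda>x. (f x)\<^sup>2)"
        using integrable_pmf_bounded[where f = f and M = M, OF f]
          integrable_pmf_bounded[where f = "\<lambda>x. (f x)\<^sup>2" and M = "M\<^sup>2" and p = \<nu>]
          power_mono[OF f abs_ge_zero, of _ 2] by auto
      show ?thesis
        using measure_pmf.variance_eq[OF int] by (simp add: m_def)
    qed
    also have "measure_pmf.expectation \<nu> (\<lambda>x. (f x)\<^sup>2) = S"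
      unfolding S_def using pmf_\<nu>_pos
      by (subst exp_finite) (auto simp: f_def power2_eq_square less_imp_neq[THEN not_sym] intro!: sum.cong)
    finally show ?thesis using \<kappa> by simp
  qed
  have "measure_pmf.expectation \<pi>t f = measure_pmf.expectation \<pi> (trans_op f t)"
    unfolding \<pi>t_def ctmc_law_def trans_op_def
    by (rule expectation_bind_pmf_bounded[where f = f, OF f])
  also have "\<dots> = measure_pmf.expectation \<pi> u + m"
    unfolding u_def
    by (subst Bochner_Integration.integral_diff)
       (auto intro!: integrable_pmf_bounded[where M = M] abs_trans_op_le f)
  finally have "S = measure_pmf.expectation \<pi> u" using S_eq by simp
  moreover have "measure_pmf.expectation \<nu> u = 0"
    using expectation_trans_op[where f = f, OF f t] unfolding u_def
    by (subst Bochner_Integration.integral_diff)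
       (auto simp: m_def intro!: integrable_pmf_bounded[where M = M] abs_trans_op_le f)
  ultimately have "(\<lambda>x. pmf \<pi> x * u x - pmf \<nu> x * u x) sums S"
    using sums_diff[OF expectation_pmf_sums[where p = \<pi> and f = u, OF u]
        expectation_pmf_sums[where p = \<nu> and f = u, OF u]] by simp
  \<comment> \<open>Young's inequality with weight \<open>\<kappa>\<close> takes the place of
    Cauchy-Schwarz: since \<open>V / \<kappa> \<le> S\<close>, half of \<open>S\<close> is absorbed
    and \<open>S \<le> \<kappa> * X\<close> remains.\<close>
  moreover have "(\<lambda>x. (\<kappa> * ((pmf \<pi> x - pmf \<nu> x)\<^sup>2 / pmf \<nu> x) + (pmf \<nu> x * (u x)\<^sup>2) / \<kappa>) / 2)
      sums ((\<kappa> * X + V / \<kappa>) / 2)"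
  proof (intro sums_divide sums_add sums_mult)
    show "(\<lambda>x. (pmf \<pi> x - pmf \<nu> x)\<^sup>2 / pmf \<nu> x) sums X"
      using sm by (simp add: X_def summable_sums)
    show "(\<lambda>x. pmf \<nu> x * (u x)\<^sup>2) sums V"
      unfolding V_def
      by (rule expectation_pmf_sums[where M = "(2 * M)\<^sup>2"]) (use power_mono[OF u abs_ge_zero, of _ 2] in auto)
  qed
  moreover have "pmf \<pi> x * u x - pmf \<nu> x * u x
      \<le> (\<kappa> * ((pmf \<pi> x - pmf \<nu> x)\<^sup>2 / pmf \<nu> x) + (pmf \<nu> x * (u x)\<^sup>2) / \<kappa>) / 2" for x
  proof -
    have "2 * (a * v) \<le> \<kappa> * (a\<^sup>2 / w) + w * v\<^sup>2 / \<kappa>" if "w > 0" for a v w :: real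
    proof -
      have "0 \<le> (\<kappa> * a - w * v)\<^sup>2 / (\<kappa> * w)" using that \<kappa> by simp
      also have "\<dots> = \<kappa> * (a\<^sup>2 / w) + w * v\<^sup>2 / \<kappa> - 2 * (a * v)"
        using that \<kappa> by (simp add: power2_eq_square field_simps)
      finally show ?thesis by simp
    qed
    from this[OF pmf_\<nu>_pos, of "pmf \<pi> x - pmf \<nu> x" "u x" x] show ?thesis
      by (simp add: left_diff_distrib)
  qed
  ultimately have "S \<le> (\<kappa> * X + V / \<kappa>) / 2"
    by (rule sums_le[rotated])
  moreover have "V / \<kappa> \<le> S"
    using \<open>V \<le> \<kappa> * S\<close> \<kappa> by (simp add: pos_divide_le_eq mult.commute)
  ultimately have "S \<le> \<kappa> * X" by simp
  then show ?thesis by (simp add: S_def \<kappa>_def X_def \<pi>t_def)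
qed

text \<open>An infinite initial distance makes the bound trivial; otherwise the truncated bounds are
  uniform in \<open>N\<close> and pass to the full series.\<close>

lemma chi_dist_contraction:
  assumes t: "t \<ge> 0"
  shows "chi_dist (ctmc_law P \<pi> t) \<nu> \<le> ennreal (exp (- \<gamma> * t)) * chi_dist \<pi> \<nu>"
proof (cases "chi_sq_dist \<pi> \<nu> = \<infinity>")
  case True
  then show ?thesis by (simp add: chi_dist_def ennreal_mult_top)
next
  case False
  note eq = chi_sq_dist_eq_suminf[OF pmf_\<nu>_pos]
  let ?a = "\<lambda>\<pi> x. (pmf \<pi> x - pmf \<nu> x)\<^sup>2 / pmf \<nu> x"
  have a: "0 \<le> ?a \<pi> x" for \<pi> :: "nat pmf" and x by simp
  have sm: "summable (?a \<pi>)"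
    using False unfolding eq by (intro summable_suminf_not_top) auto
  note le = chi_sq_partial_sum_le[OF sm t]
  have "summable (?a (ctmc_law P \<pi> t))"
    by (rule summableI_nonneg_bounded[OF a le])
  then have "chi_sq_dist (ctmc_law P \<pi> t) \<nu> = ennreal (suminf (?a (ctmc_law P \<pi> t)))"
    unfolding eq by (intro suminf_ennreal2) auto
  also have "\<dots> \<le> ennreal ((exp (- \<gamma> * t))\<^sup>2 * suminf (?a \<pi>))"
    by (intro ennreal_leI suminf_le_const le \<open>summable (?a (ctmc_law P \<pi> t))\<close>)
  also have "\<dots> = ennreal ((exp (- \<gamma> * t))\<^sup>2) * chi_sq_dist \<pi> \<nu>"
    unfolding eq using suminf_ennreal2[OF a sm] by (simp add: ennreal_mult suminf_nonneg[OF sm a])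
  finally show ?thesis
    by (rule chi_dist_le_of_chi_sq_dist_le[OF False, rotated]) simp
qed

end

section \<open>Spectral gap bound for the M/M/n queue\<close>

text \<open>The right-hand side is the expression bounded in assumption \<open>gap\<close> for the weights
  \<open>\<theta>\<^sub>i = min (\<mu>\<^sub>i / \<lambda>) (sqrt (\<mu>\<^sub>i / \<lambda>))\<close>, where \<open>a = sqrt \<lambda>\<close>, \<open>s = sqrt \<mu>\<^sub>i\<close>, \<open>t = sqrt \<mu>\<^sub>j\<close> with \<open>j = i + 1 \<le> n\<close>.\<close>

lemma mmn_local_gap:
  fixes a s t :: real
  assumes "0 < a" "0 \<le> s" "0 \<le> t" "t\<^sup>2 = s\<^sup>2 + 1"
  shows "1 / 2 \<le> a\<^sup>2 - s * min s a + t\<^sup>2 - a * max a t"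
proof -
  have at: "2 * (a * t) \<le> a\<^sup>2 + t\<^sup>2" and as: "2 * (a * s) \<le> a\<^sup>2 + s\<^sup>2"
    using sum_squares_bound[of a t] sum_squares_bound[of a s] by (simp_all add: mult.assoc)
  have "s \<le> t" using assms by (intro power2_le_imp_le[of s t]) auto
  \<comment> \<open>The first case has the exact value \<open>t\<^sup>2 - s\<^sup>2 = 1\<close>. In
    the second, \<open>at\<close> and \<open>s \<le> a\<close> leave 1/2; in the third,
    \<open>at\<close> and \<open>as\<close> leave half of
    \<open>t\<^sup>2 - s\<^sup>2\<close>.\<close>
  consider "t \<le> a" | "s \<le> a" "a < t" | "a < s" by linarith
  then show ?thesis
  proof cases
    case 1
    then show ?thesis using \<open>s \<le> t\<close> assms(4) by (simp add: min_def max_def power2_eq_square)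
  next
    case 2
    have "s\<^sup>2 \<le> a\<^sup>2" using 2 assms by (intro power_mono) auto
    then show ?thesis using 2 at assms(4) by (simp add: min_def max_def power2_eq_square)
  next
    case 3
    then show ?thesis using at as \<open>s \<le> t\<close> assms(4) by (simp add: min_def max_def mult.commute[of s a])
  qed
qed

text \<open>The two upper bounds on \<open>r\<close> match two ranges of states: 1/2 comes from
  states below \<open>n\<close>, and the square is the exact value of the gap expression from
  \<open>n\<close> on.\<close>

lemma mmn_chi_decay_of_le_gap:
  assumes n: "n > 0" and l: "0 < l" "l < real n" and r: "0 < r"
    and r_le: "r \<le> 1 / 2" "r \<le> (sqrt (real n) - sqrt l)\<^sup>2"
  shows "mmn_chi_decay n l r"
  unfolding mmn_chi_decay_def
proof (intro allI impI)
  fix P \<nu> and \<pi> :: "nat pmf" and t :: real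
  assume P: "ctmc_transition (mmn_rate n l) P" and \<nu>: "ctmc_stationary P \<nu>" and t: "0 \<le> t"
  define \<mu> where "\<mu> q = real (min n q)" for q
  \<comment> \<open>This is the minimum of \<open>\<mu> i / l\<close> and its square root, written
    so that only square roots of rates occur.\<close>
  define \<theta> where "\<theta> i = sqrt (\<mu> i) * min (sqrt (\<mu> i)) (sqrt l) / l" for i
  have \<mu>: "0 \<le> \<mu> i" "\<mu> i \<le> n" for i by (auto simp: \<mu>_def)
  have \<mu>_pos: "0 < \<mu> (Suc i)" for i using n by (simp add: \<mu>_def)
  have \<theta>_pos: "0 < \<theta> (Suc i)" for i using \<mu>_pos[of i] l by (simp add: \<theta>_def)
  have \<theta>_le: "\<theta> i \<le> sqrt n * sqrt l / l" for i
    unfolding \<theta>_def using l \<mu>[of i] by (intro divide_right_mono mult_mono) auto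
  have gap: "r \<le> l * (1 - \<theta> i) + \<mu> (Suc i) * (1 - 1 / \<theta> (Suc i))" for i
  proof -
    define a s t where ast: "a = sqrt l" "s = sqrt (\<mu> i)" "t = sqrt (\<mu> (Suc i))"
    have a: "0 < a" and s: "0 \<le> s" and t: "0 < t" using l \<mu> \<mu>_pos by (auto simp: ast)
    have sq: "l = a\<^sup>2" "\<mu> i = s\<^sup>2" "\<mu> (Suc i) = t\<^sup>2" using l \<mu> by (auto simp: ast)
    have "l * (1 - \<theta> i) = a\<^sup>2 - s * min s a"
      using a unfolding \<theta>_def ast[symmetric] sq(1) by (simp add: right_diff_distrib)
    moreover have "\<mu> (Suc i) * (1 - 1 / \<theta> (Suc i)) = t\<^sup>2 - a * max a t"
      using a t unfolding \<theta>_def ast[symmetric] sq(1,3)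
      by (auto simp: min_def max_def power2_eq_square field_simps)
    moreover have "r \<le> a\<^sup>2 - s * min s a + t\<^sup>2 - a * max a t"
    \<comment> \<open>For \<open>i < n\<close> the death rate still grows by one from
      \<open>i\<close> to \<open>Suc i\<close>, including \<open>i = n - 1\<close>; afterwards both
      rates are \<open>n\<close>.\<close>
    proof (cases "i < n")
      case True
      then have "t\<^sup>2 = s\<^sup>2 + 1" by (simp add: \<mu>_def flip: sq)
      from mmn_local_gap[OF a s _ this] t r_le show ?thesis by simp
    next
      case False
      then have eq: "s = sqrt n" "t = sqrt n" by (simp_all add: ast \<mu>_def)
      have "a < sqrt n" using l by (simp add: ast)
      then have "a\<^sup>2 - s * min s a + t\<^sup>2 - a * max a t = (sqrt n - sqrt l)\<^sup>2"
        unfolding eq ast(1)[symmetric] by (simp add: power2_eq_square algebra_simps)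
      then show ?thesis using r_le by simp
    qed
    ultimately show ?thesis by simp
  qed
  \<comment> \<open>All rates are at most \<open>real n\<close>, and the ratio of birth to death
    rate is \<open>l / n < 1\<close> from state \<open>n\<close> on.\<close>
  interpret gapped_birth_death "\<lambda>_. l" \<mu> "real n" P \<nu> \<theta> r "sqrt n * sqrt l / l" "l / n" n
  proof unfold_locales
    show "ctmc_transition (birth_death_rate (\<lambda>_. l) \<mu>) P"
      using P by (simp add: mmn_rate_def \<mu>_def[abs_def])
    show "\<theta> 0 = 0" by (simp add: \<theta>_def \<mu>_def)
    show "\<mu> 0 = 0" by (simp add: \<mu>_def)
    show "l \<le> l / real n * \<mu> (Suc i)" if "n \<le> i" for i
      using that n by (simp add: \<mu>_def)
  qed (use l n \<nu> r \<mu> \<mu>_pos \<theta>_pos \<theta>_le gap in auto)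
  show "chi_dist (ctmc_law P \<pi> t) \<nu> \<le> ennreal (exp (- r * t)) * chi_dist \<pi> \<nu>"
    by (rule chi_dist_contraction[OF t])
qed

section \<open>Heavy-traffic arrival rates and the four regimes\<close>

lemma hw_arrival_bounds:
  assumes "\<alpha> > 0" "n \<ge> 2"
  shows "0 < hw_arrival \<alpha> n" "hw_arrival \<alpha> n < real n"
proof -
  have "real n powr (1 - \<alpha>) < real n powr 1"
    using assms by (intro powr_less_mono) auto
  then show "0 < hw_arrival \<alpha> n" using assms by (simp add: hw_arrival_def)
  show "hw_arrival \<alpha> n < real n" using assms by (simp add: hw_arrival_def)
qed

text \<open>With \<open>x = sqrt n\<close> and \<open>y = sqrt l\<close>, the identity
  \<open>(x - y) * (x + y) = n powr (1 - \<alpha>)\<close> is squared, and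
  \<open>x \<le> x + y \<le> 2 * x\<close> bounds the second factor.\<close>

lemma hw_gap_bounds:
  assumes \<alpha>: "\<alpha> > 0" and n: "n \<ge> 2"
  defines "g \<equiv> (sqrt (real n) - sqrt (hw_arrival \<alpha> n))\<^sup>2"
  shows "real n powr (1 - 2 * \<alpha>) / 4 \<le> g" "g \<le> real n powr (1 - 2 * \<alpha>)"
proof -
  define l x y where "l = hw_arrival \<alpha> n" and "x = sqrt (real n)" and "y = sqrt l"
  have l: "0 < l" "l < real n" using hw_arrival_bounds[OF \<alpha> n] by (auto simp: l_def)
  have xy: "0 < y" "y < x" "x\<^sup>2 = real n" "y\<^sup>2 = l" using l by (auto simp: x_def y_def)
  define z where "z = real n powr (1 - 2 * \<alpha>)"
  have "z * real n = (real n powr (1 - \<alpha>))\<^sup>2"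
    using n powr_add[of "real n" "1 - 2 * \<alpha>" 1] by (simp add: z_def power2_eq_square flip: powr_add)
  also have "real n powr (1 - \<alpha>) = x\<^sup>2 - y\<^sup>2"
    by (simp add: xy l_def hw_arrival_def)
  also have "\<dots> = (x - y) * (x + y)"
    by (simp add: power2_eq_square algebra_simps)
  finally have eq: "z * x\<^sup>2 = g * (x + y)\<^sup>2"
    by (simp add: xy g_def l_def x_def y_def power_mult_distrib)
  have g: "0 \<le> g" by (simp add: g_def)
  have "z * x\<^sup>2 \<le> g * (2 * x)\<^sup>2"
    unfolding eq using xy g by (intro mult_left_mono power_mono) auto
  then have "z * x\<^sup>2 \<le> (4 * g) * x\<^sup>2" by (simp add: power_mult_distrib)
  then have "z \<le> 4 * g" by (rule mult_right_le_imp_le) (use xy n in simp)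
  then show "real n powr (1 - 2 * \<alpha>) / 4 \<le> g" by (simp add: z_def)
  have "g * x\<^sup>2 \<le> z * x\<^sup>2"
    unfolding eq using xy g by (intro mult_left_mono power_mono) auto
  then have "g \<le> z" by (rule mult_right_le_imp_le) (use xy n in simp)
  then show "g \<le> real n powr (1 - 2 * \<alpha>)" by (simp add: z_def)
qed

lemma mmn_chi_decay_hw:
  assumes "\<alpha> > 0" "n \<ge> 2" "0 < r" "r \<le> 1 / 2" "r \<le> (sqrt (real n) - sqrt (hw_arrival \<alpha> n))\<^sup>2"
  shows "mmn_chi_decay n (hw_arrival \<alpha> n) r"
  using assms hw_arrival_bounds[of \<alpha> n] by (intro mmn_chi_decay_of_le_gap) auto

theorem theorem1:
  fixes \<alpha> :: real
  assumes "\<alpha> > 0"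
  shows
    "(\<alpha> \<ge> 1 \<longrightarrow>
       (\<forall>n\<ge>2. mmn_chi_decay n (hw_arrival \<alpha> n) ((sqrt (real n) - sqrt (hw_arrival \<alpha> n))\<^sup>2)))
     \<and> (1/2 < \<alpha> \<and> \<alpha> < 1 \<longrightarrow>
       (\<exists>C :: nat \<Rightarrow> real. (\<forall>n\<ge>2. C n > 0) \<and> C \<longlonglongrightarrow> 1 \<and>
         (\<forall>n\<ge>2. mmn_chi_decay n (hw_arrival \<alpha> n)
            (C n * (sqrt (real n) - sqrt (hw_arrival \<alpha> n))\<^sup>2))))
     \<and> (\<alpha> < 1/2 \<longrightarrow>
       (\<exists>D :: nat \<Rightarrow> real. (\<forall>n\<ge>2. D n > 0) \<and> D \<longlonglongrightarrow> 1/25 \<and>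
         (\<forall>n\<ge>2. mmn_chi_decay n (hw_arrival \<alpha> n) (D n))))
     \<and> (\<alpha> = 1/2 \<longrightarrow>
       (\<exists>H :: nat \<Rightarrow> real. (\<forall>n\<ge>110. H n > 1/10861) \<and> H \<longlonglongrightarrow> 1/1781 \<and>
         (\<forall>n\<ge>110. mmn_chi_decay n (hw_arrival \<alpha> n) (H n))))"
proof -
  let ?g = "\<lambda>n. (sqrt (real n) - sqrt (hw_arrival \<alpha> n))\<^sup>2"
  have g_ge: "?g n \<ge> real n powr (1 - 2 * \<alpha>) / 4" and g_le: "?g n \<le> real n powr (1 - 2 * \<alpha>)"
    if "n \<ge> 2" for n
    using hw_gap_bounds[OF assms that] by auto
  have g_pos: "?g n > 0" if "n \<ge> 2" for n
  proof -
    have "0 < real n powr (1 - 2 * \<alpha>) / 4" using that by simp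
    with g_ge[OF that] show ?thesis by linarith
  qed
  have i: "mmn_chi_decay n (hw_arrival \<alpha> n) (?g n)" if "\<alpha> \<ge> 1" "n \<ge> 2" for n
  proof (rule mmn_chi_decay_hw[OF assms that(2) g_pos[OF that(2)]])
    \<comment> \<open>For \<open>\<alpha> \<ge> 1\<close> the gap is at most \<open>1 / n\<close>,
      so the cap 1/2 does not bind.\<close>
    have "real n powr (1 - 2 * \<alpha>) \<le> real n powr (- 1)"
      using that by (intro powr_mono) auto
    also have "\<dots> \<le> 1 / 2" using that by (simp add: powr_minus_divide field_simps)
    finally show "?g n \<le> 1 / 2" using g_le[OF that(2)] by simp
  qed simp
  have ii: "\<exists>C. (\<forall>n\<ge>2. C n > 0) \<and> C \<longlonglongrightarrow> 1 \<and> (\<forall>n\<ge>2. mmn_chi_decay n (hw_arrival \<alpha> n) (C n * ?g n))"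
    if \<alpha>: "1 / 2 < \<alpha>"
  proof (intro exI conjI allI impI)
    \<comment> \<open>This makes \<open>?C n * ?g n\<close> the minimum of \<open>?g n\<close> and
      1/2. As \<open>?g n\<close> tends to 0, the factor is eventually equal to 1.\<close>
    let ?C = "\<lambda>n. min 1 (1 / (2 * ?g n))"
    show "?C n > 0" if "n \<ge> 2" for n using g_pos[OF that] by simp
    have "(\<lambda>n. real n powr (1 - 2 * \<alpha>)) \<longlonglongrightarrow> 0"
      using \<alpha> by (intro tendsto_neg_powr filterlim_real_sequentially) auto
    then have "eventually (\<lambda>n. real n powr (1 - 2 * \<alpha>) < 1 / 2) sequentially"
      by (rule order_tendstoD) simp
    then have "eventually (\<lambda>n. ?C n = 1) sequentially"
      using eventually_ge_at_top[of 2]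
    proof eventually_elim
      case (elim n)
      then show ?case using g_pos[of n] g_le[of n] by (simp add: min_def field_simps)
    qed
    then show "?C \<longlonglongrightarrow> 1" by (rule tendsto_eventually)
    show "mmn_chi_decay n (hw_arrival \<alpha> n) (?C n * ?g n)" if "n \<ge> 2" for n
    proof (rule mmn_chi_decay_hw[OF assms that])
      show "0 < ?C n * ?g n" using g_pos[OF that] by simp
      have "?C n * ?g n \<le> 1 / (2 * ?g n) * ?g n" by (intro mult_right_mono) auto
      then show "?C n * ?g n \<le> 1 / 2" using g_pos[OF that] by simp
      have "?C n * ?g n \<le> 1 * ?g n" by (intro mult_right_mono) auto
      then show "?C n * ?g n \<le> ?g n" by simp
    qed
  qed
  have iii_iv: "mmn_chi_decay n (hw_arrival \<alpha> n) r" if "\<alpha> \<le> 1 / 2" "n \<ge> 2" "0 < r" "r \<le> 1 / 4" for n r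
  proof (rule mmn_chi_decay_hw[OF assms that(2,3)])
    \<comment> \<open>The exponent is nonnegative, so the gap is at least 1/4 and every positive
      rate up to 1/4 is admissible.\<close>
    have "1 \<le> real n powr (1 - 2 * \<alpha>)" using that by (intro ge_one_powr_ge_zero) auto
    then show "r \<le> ?g n" using g_ge[OF that(2)] that by linarith
  qed (use that in simp)
  \<comment> \<open>Constant sequences at the prescribed limits suffice, here and for
    \<open>\<alpha> = 1/2\<close>: both 1/25 and 1/1781 lie below 1/4, and 1/1781 exceeds
    1/10861.\<close>
  have iii: "\<exists>D. (\<forall>n\<ge>2. D n > 0) \<and> D \<longlonglongrightarrow> 1/25 \<and> (\<forall>n\<ge>2. mmn_chi_decay n (hw_arrival \<alpha> n) (D n))"
    if "\<alpha> < 1/2"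
    using that by (intro exI[of _ "\<lambda>_. 1/25"]) (auto intro!: iii_iv)
  have iv: "\<exists>H. (\<forall>n\<ge>110. H n > 1/10861) \<and> H \<longlonglongrightarrow> 1/1781 \<and>
      (\<forall>n\<ge>110. mmn_chi_decay n (hw_arrival \<alpha> n) (H n))" if "\<alpha> = 1/2"
    using that by (intro exI[of _ "\<lambda>_. 1/1781"]) (auto intro!: iii_iv)
  show ?thesis using i ii iii iv by blast
qed

end
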